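(* Let $(\mathfrak A,p)$ be a translation-invariant net of algebras with a translation-invariant net of projections on $\mathbb Z^\ell$ satisfying (LTO2), (LTO3) and (LTO4) with constants $r,s>0$. Let $\Lambda$ be a sufficiently large rectangle in the half-space $\mathbb H$, let $\Delta\subset\mathbb H$ be a rectangle with $\Lambda\Subset_s\Delta$ and $\partial\Lambda\cap\partial\Delta=I\subset\mathcal K$, and let $x\in\mathfrak A(\Lambda)$. Then the operator $\mathbb E_\Delta(x)\in\mathfrak B(I)$ satisfying $p_\Delta xp_\Delta=\mathbb E_\Delta(x)p_\Delta$ is independent of the choice of such $\Delta$.
   Context: A rectangle in $\mathbb Z^\ell$ is a product of bounded integer intervals, viewed as a finite set of sites; $\partial\Lambda$ is the set of sites of $\Lambda$ on its boundary faces. A net of algebras assigns to each rectangle $\Lambda$ a C*-subalgebra $\mathfrak A(\Lambda)$ of a unital C*-algebra $\mathfrak A$ with $\mathfrak A(\emptyset)=\mathbb C1$, $\mathfrak A(\Lambda)\subset\mathfrak A(\Delta)$ if $\Lambda\subset\Delta$, $[\mathfrak A(\Lambda),\mathfrak A(\Delta)]=0$ if $\Lambda\cap\Delta=\emptyset$, and $\bigcup_\Lambda\mathfrak A(\Lambda)$ norm dense. A net of projections assigns to each rectangle a nonzero orthogonal projection $p_\Lambda\in\mathfrak A(\Lambda)$ with $p_\Delta\le p_\Lambda$ if $\Lambda\subset\Delta$. Translation invariant: $\mathbb Z^\ell$ acts on $\mathfrak A$ by $*$-automorphisms with $g\cdot\mathfrak A(\Lambda)=\mathfrak A(g+\Lambda)$,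 $g\cdot p_\Lambda=p_{g+\Lambda}$. $\Lambda$ is sufficiently large if it contains a cube with $r$ sites per side. $\Lambda\Subset_s\Delta$ means: $\Lambda\subset\Delta$, $\partial\Lambda\cap\partial\Delta$ is a nonempty $(\ell-1)$-dimensional rectangle, and every site of $\Delta\setminus\Lambda$ lies in a cube with $s$ sites per side contained in $\Delta\setminus\Lambda$. For $\Lambda\Subset_s\Delta$ put $\mathfrak B(\Lambda\Subset_s\Delta)=\{xp_\Delta: x\in p_\Lambda\mathfrak A(\Lambda)p_\Lambda,\ xp_{\Delta'}=p_{\Delta'}x$ whenever $\Lambda\Subset_s\Delta'$ with $\partial\Lambda\cap\partial\Delta'=\partial\Lambda\cap\partial\Delta\}$. Axioms (for sufficiently large $\Lambda,\Lambda_1,\Lambda_2$): (LTO2) if $\Lambda\Subset_s\Delta$ then $p_\Delta\mathfrak A(\Lambda)p_\Delta=\mathfrak B(\Lambda\Subset_s\Delta)$. (LTO3) if $\Lambda_1\subset\Lambda_2\Subset_s\Delta$ with $\partial\Lambda_1\cap\partial\Delta=\partial\Lambda_2\cap\partial\Delta$ then $\mathfrak B(\Lambda_1\Subset_s\Delta)=\mathfrak B(\Lambda_2\Subset_s\Delta)$. (LTO4) if $\Lambda\Subset_s\Delta_1\subset\Delta_2$ with $\partial\Lambda\cap\partial\Delta_1=\partial\Lambda\cap\partial\Delta_2$, $x\in\mathfrak B(\Lambda\Subset_s\Delta_1)$ and $xp_{\Delta_2}=0$, then $x=0$. $\mathcal K$ is a codimension-one coordinate sublattice of $\mathbb Z^\ell$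 and $\mathbb H$ a chosen half-space bounded by and containing $\mathcal K$. For $I\subset\mathcal K$, $\Lambda_I\subset\mathbb H$ is the smallest sufficiently large rectangle with $\partial\Lambda_I\cap\mathcal K=I$, $\Delta_I\subset\mathbb H$ is the smallest rectangle with $\Lambda_I\Subset_s\Delta_I$ and $\partial\Lambda_I\cap\partial\Delta_I=I$, and $\mathfrak B(I)=\mathfrak B(\Lambda_I\Subset_s\Delta_I)$. Under these axioms $\mathfrak B(I)p_\Delta=\mathfrak B(\Lambda\Subset_s\Delta)=p_\Delta\mathfrak A(\Lambda)p_\Delta$ and $y\mapsto yp_\Delta$ is injective on $\mathfrak B(I)$, so $\mathbb E_\Delta(x)$ exists and is unique. *)

theory Defs
  imports "HOL-Analysis.Analysis"
begin

section \<open>C*-algebras\<close>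

text \<open>
  The superclass \<^class>\<open>real_normed_algebra_1\<close> contains $0 \neq 1$ and $\|1\| = 1$. The only unital C*-algebra this
  excludes is the zero algebra, which has no nonzero projection.
\<close>

class unital_cstar_algebra = real_normed_algebra_1 + banach +
  fixes scaleC :: "complex \<Rightarrow> 'a \<Rightarrow> 'a"  (infixr \<open>*\<^sub>C\<close> 75)
    and star :: "'a \<Rightarrow> 'a"
  assumes scaleC_of_real: "complex_of_real r *\<^sub>C x = r *\<^sub>R x"
    and scaleC_add_right: "c *\<^sub>C (x + y) = c *\<^sub>C x + c *\<^sub>C y"
    and scaleC_add_left: "(c + d) *\<^sub>C x = c *\<^sub>C x + d *\<^sub>C x"
    and scaleC_scaleC: "c *\<^sub>C d *\<^sub>C x = (c * d) *\<^sub>C x"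
    and mult_scaleC_left: "(c *\<^sub>C x) * y = c *\<^sub>C (x * y)"
    and mult_scaleC_right: "x * (c *\<^sub>C y) = c *\<^sub>C (x * y)"
    and norm_scaleC: "norm (c *\<^sub>C x) = cmod c * norm x"
    and star_star: "star (star x) = x"
    and star_add: "star (x + y) = star x + star y"
    and star_scaleC: "star (c *\<^sub>C x) = cnj c *\<^sub>C star x"
    and star_mult: "star (x * y) = star y * star x"
    and cstar_identity: "norm (star x * x) = (norm x)\<^sup>2"

definition cstar_subalgebra :: "'a::unital_cstar_algebra set \<Rightarrow> bool" where
  "cstar_subalgebra S \<longleftrightarrow>
     0 \<in> S \<and>
     (\<forall>x\<in>S. \<forall>y\<in>S. x + y \<in> S) \<and>
     (\<forall>c. \<forall>x\<in>S. c *\<^sub>C x \<in> S) \<and>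
     (\<forall>x\<in>S. \<forall>y\<in>S. x * y \<in> S) \<and>
     (\<forall>x\<in>S. star x \<in> S) \<and>
     closed S"

definition star_automorphism :: "('a::unital_cstar_algebra \<Rightarrow> 'a) \<Rightarrow> bool" where
  "star_automorphism f \<longleftrightarrow>
     bij f \<and>
     (\<forall>x y. f (x + y) = f x + f y) \<and>
     (\<forall>c x. f (c *\<^sub>C x) = c *\<^sub>C f x) \<and>
     (\<forall>x y. f (x * y) = f x * f y) \<and>
     (\<forall>x. f (star x) = star (f x))"

definition projection :: "'a::unital_cstar_algebra \<Rightarrow> bool" where
  "projection p \<longleftrightarrow> p * p = p \<and> star p = p"

text \<open>The order on projections; taking adjoints, \<^prop>\<open>p * q = p\<close> also gives \<^prop>\<open>q * p = p\<close>.\<close>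

definition projection_le :: "'a::unital_cstar_algebra \<Rightarrow> 'a \<Rightarrow> bool" where
  "projection_le p q \<longleftrightarrow> p * q = p"


section \<open>Rectangles in the lattice\<close>

text \<open>
  The lattice $\mathbb{Z}^\ell$ is \<^typ>\<open>int ^ 'n\<close> with $\ell$ the cardinality of \<^typ>\<open>'n\<close>.
  The empty set is a rectangle.
\<close>

definition rectangle :: "(int ^ 'n) set \<Rightarrow> bool" where
  "rectangle R \<longleftrightarrow> (\<exists>a b. R = {x. \<forall>i. a $ i \<le> x $ i \<and> x $ i \<le> b $ i})"

definition cube :: "nat \<Rightarrow> (int ^ 'n) set \<Rightarrow> bool" where
  "cube m Q \<longleftrightarrow> (\<exists>a. Q = {x. \<forall>i. a $ i \<le> x $ i \<and> x $ i < a $ i + int m})"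

text \<open>Sites of a rectangle at which some coordinate attains its maximum or its minimum.\<close>

definition bdry :: "(int ^ 'n) set \<Rightarrow> (int ^ 'n) set" where
  "bdry R = {x \<in> R. \<exists>i. (\<forall>y\<in>R. y $ i \<le> x $ i) \<or> (\<forall>y\<in>R. x $ i \<le> y $ i)}"

text \<open>
  A nonempty $(\ell-1)$-dimensional rectangle: a product of $\ell - 1$ nonempty intervals inside a
  translate of a coordinate sublattice of codimension one. As for rectangles in $\mathbb{Z}^\ell$,
  these intervals may consist of a single site.
\<close>

definition codim1_rectangle :: "(int ^ 'n) set \<Rightarrow> bool" where
  "codim1_rectangle R \<longleftrightarrow> rectangle R \<and> R \<noteq> {} \<and> (\<exists>k c. \<forall>x\<in>R. x $ k = c)"

definition sufficiently_large :: "nat \<Rightarrow> (int ^ 'n) set \<Rightarrow> bool" where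
  "sufficiently_large r R \<longleftrightarrow> (\<exists>Q. cube r Q \<and> Q \<subseteq> R)"

text \<open>The relation $\Lambda \Subset_s \Delta$.\<close>

definition surrounded :: "nat \<Rightarrow> (int ^ 'n) set \<Rightarrow> (int ^ 'n) set \<Rightarrow> bool" where
  "surrounded s \<Lambda> \<Delta> \<longleftrightarrow>
     rectangle \<Lambda> \<and> rectangle \<Delta> \<and> \<Lambda> \<subseteq> \<Delta> \<and>
     codim1_rectangle (bdry \<Lambda> \<inter> bdry \<Delta>) \<and>
     (\<forall>x \<in> \<Delta> - \<Lambda>. \<exists>Q. cube s Q \<and> x \<in> Q \<and> Q \<subseteq> \<Delta> - \<Lambda>)"

definition coord_sublattice :: "'n \<Rightarrow> (int ^ 'n) set" where
  "coord_sublattice k = {x. x $ k = 0}"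

definition half_space :: "'n \<Rightarrow> (int ^ 'n) set \<Rightarrow> bool" where
  "half_space k H \<longleftrightarrow> H = {x. x $ k \<ge> 0} \<or> H = {x. x $ k \<le> 0}"


section \<open>Nets of algebras and nets of projections\<close>

text \<open>Nets are total functions on sets of sites; only their values on rectangles are relevant.\<close>

definition net_of_algebras :: "((int ^ 'n) set \<Rightarrow> 'a::unital_cstar_algebra set) \<Rightarrow> bool" where
  "net_of_algebras \<AA> \<longleftrightarrow>
     (\<forall>\<Lambda>. rectangle \<Lambda> \<longrightarrow> cstar_subalgebra (\<AA> \<Lambda>)) \<and>
     \<AA> {} = range (\<lambda>c. c *\<^sub>C 1) \<and>
     (\<forall>\<Lambda> \<Delta>. rectangle \<Lambda> \<and> rectangle \<Delta> \<and> \<Lambda> \<subseteq> \<Delta> \<longrightarrow> \<AA> \<Lambda> \<subseteq> \<AA> \<Delta>) \<and>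
     (\<forall>\<Lambda> \<Delta>. rectangle \<Lambda> \<and> rectangle \<Delta> \<and> \<Lambda> \<inter> \<Delta> = {} \<longrightarrow>
        (\<forall>x \<in> \<AA> \<Lambda>. \<forall>y \<in> \<AA> \<Delta>. x * y = y * x)) \<and>
     closure (\<Union>\<Lambda>\<in>Collect rectangle. \<AA> \<Lambda>) = UNIV"

definition net_of_projections ::
  "((int ^ 'n) set \<Rightarrow> 'a::unital_cstar_algebra set) \<Rightarrow> ((int ^ 'n) set \<Rightarrow> 'a) \<Rightarrow> bool" where
  "net_of_projections \<AA> p \<longleftrightarrow>
     (\<forall>\<Lambda>. rectangle \<Lambda> \<longrightarrow> p \<Lambda> \<in> \<AA> \<Lambda> \<and> projection (p \<Lambda>) \<and> p \<Lambda> \<noteq> 0) \<and>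
     (\<forall>\<Lambda> \<Delta>. rectangle \<Lambda> \<and> rectangle \<Delta> \<and> \<Lambda> \<subseteq> \<Delta> \<longrightarrow> projection_le (p \<Delta>) (p \<Lambda>))"

text \<open>Translation invariance with respect to an action \<open>\<alpha>\<close> of the lattice on the ambient algebra.\<close>

definition translation_invariant ::
  "(int ^ 'n \<Rightarrow> 'a::unital_cstar_algebra \<Rightarrow> 'a) \<Rightarrow> ((int ^ 'n) set \<Rightarrow> 'a set) \<Rightarrow>
   ((int ^ 'n) set \<Rightarrow> 'a) \<Rightarrow> bool" where
  "translation_invariant \<alpha> \<AA> p \<longleftrightarrow>
     (\<forall>g. star_automorphism (\<alpha> g)) \<and>
     \<alpha> 0 = id \<and> (\<forall>g h. \<alpha> (g + h) = \<alpha> g \<circ> \<alpha> h) \<and>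
     (\<forall>g \<Lambda>. rectangle \<Lambda> \<longrightarrow> \<alpha> g ` \<AA> \<Lambda> = \<AA> ((+) g ` \<Lambda>) \<and> \<alpha> g (p \<Lambda>) = p ((+) g ` \<Lambda>))"

definition corner :: "'a::unital_cstar_algebra \<Rightarrow> 'a set \<Rightarrow> 'a set" where
  "corner e S = (\<lambda>x. e * x * e) ` S"

text \<open>The algebra $\mathfrak{B}(\Lambda \Subset_s \Delta)$, meaningful for \<^term>\<open>surrounded s \<Lambda> \<Delta>\<close>.\<close>

definition BB ::
  "nat \<Rightarrow> ((int ^ 'n) set \<Rightarrow> 'a::unital_cstar_algebra set) \<Rightarrow> ((int ^ 'n) set \<Rightarrow> 'a) \<Rightarrow>
   (int ^ 'n) set \<Rightarrow> (int ^ 'n) set \<Rightarrow> 'a set" where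
  "BB s \<AA> p \<Lambda> \<Delta> = {x * p \<Delta> | x. x \<in> corner (p \<Lambda>) (\<AA> \<Lambda>) \<and>
     (\<forall>\<Delta>'. surrounded s \<Lambda> \<Delta>' \<and> bdry \<Lambda> \<inter> bdry \<Delta>' = bdry \<Lambda> \<inter> bdry \<Delta> \<longrightarrow>
        x * p \<Delta>' = p \<Delta>' * x)}"

definition LTO2 ::
  "nat \<Rightarrow> nat \<Rightarrow> ((int ^ 'n) set \<Rightarrow> 'a::unital_cstar_algebra set) \<Rightarrow>
   ((int ^ 'n) set \<Rightarrow> 'a) \<Rightarrow> bool" where
  "LTO2 r s \<AA> p \<longleftrightarrow>
     (\<forall>\<Lambda> \<Delta>. sufficiently_large r \<Lambda> \<and> surrounded s \<Lambda> \<Delta> \<longrightarrow>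
        corner (p \<Delta>) (\<AA> \<Lambda>) = BB s \<AA> p \<Lambda> \<Delta>)"

definition LTO3 ::
  "nat \<Rightarrow> nat \<Rightarrow> ((int ^ 'n) set \<Rightarrow> 'a::unital_cstar_algebra set) \<Rightarrow>
   ((int ^ 'n) set \<Rightarrow> 'a) \<Rightarrow> bool" where
  "LTO3 r s \<AA> p \<longleftrightarrow>
     (\<forall>\<Lambda>\<^sub>1 \<Lambda>\<^sub>2 \<Delta>. rectangle \<Lambda>\<^sub>1 \<and> sufficiently_large r \<Lambda>\<^sub>1 \<and> sufficiently_large r \<Lambda>\<^sub>2 \<and>
        \<Lambda>\<^sub>1 \<subseteq> \<Lambda>\<^sub>2 \<and> surrounded s \<Lambda>\<^sub>2 \<Delta> \<and> bdry \<Lambda>\<^sub>1 \<inter> bdry \<Delta> = bdry \<Lambda>\<^sub>2 \<inter> bdry \<Delta> \<longrightarrow>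
        BB s \<AA> p \<Lambda>\<^sub>1 \<Delta> = BB s \<AA> p \<Lambda>\<^sub>2 \<Delta>)"

definition LTO4 ::
  "nat \<Rightarrow> nat \<Rightarrow> ((int ^ 'n) set \<Rightarrow> 'a::unital_cstar_algebra set) \<Rightarrow>
   ((int ^ 'n) set \<Rightarrow> 'a) \<Rightarrow> bool" where
  "LTO4 r s \<AA> p \<longleftrightarrow>
     (\<forall>\<Lambda> \<Delta>\<^sub>1 \<Delta>\<^sub>2 x. sufficiently_large r \<Lambda> \<and> surrounded s \<Lambda> \<Delta>\<^sub>1 \<and> rectangle \<Delta>\<^sub>2 \<and> \<Delta>\<^sub>1 \<subseteq> \<Delta>\<^sub>2 \<and>
        bdry \<Lambda> \<inter> bdry \<Delta>\<^sub>1 = bdry \<Lambda> \<inter> bdry \<Delta>\<^sub>2 \<and>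
        x \<in> BB s \<AA> p \<Lambda> \<Delta>\<^sub>1 \<and> x * p \<Delta>\<^sub>2 = 0 \<longrightarrow> x = 0)"


section \<open>The boundary algebras\<close>

text \<open>
  In the following, \<open>I\<close> is a subset of \<^term>\<open>coord_sublattice k\<close>, and \<open>H\<close> is one of the two
  half-spaces bounded by it. The rectangles $\Lambda_I$ and $\Delta_I$ are least with respect to
  inclusion.
\<close>

definition Lambda_of ::
  "nat \<Rightarrow> 'n \<Rightarrow> (int ^ 'n) set \<Rightarrow> (int ^ 'n) set \<Rightarrow> (int ^ 'n) set" where
  "Lambda_of r k H I =
     (LEAST \<Lambda>. rectangle \<Lambda> \<and> sufficiently_large r \<Lambda> \<and> \<Lambda> \<subseteq> H \<and>
        bdry \<Lambda> \<inter> coord_sublattice k = I)"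

definition Delta_of ::
  "nat \<Rightarrow> nat \<Rightarrow> 'n \<Rightarrow> (int ^ 'n) set \<Rightarrow> (int ^ 'n) set \<Rightarrow> (int ^ 'n) set" where
  "Delta_of r s k H I =
     (LEAST \<Delta>. rectangle \<Delta> \<and> \<Delta> \<subseteq> H \<and> surrounded s (Lambda_of r k H I) \<Delta> \<and>
        bdry (Lambda_of r k H I) \<inter> bdry \<Delta> = I)"

definition boundary_algebra ::
  "nat \<Rightarrow> nat \<Rightarrow> ((int ^ 'n) set \<Rightarrow> 'a::unital_cstar_algebra set) \<Rightarrow>
   ((int ^ 'n) set \<Rightarrow> 'a) \<Rightarrow> 'n \<Rightarrow> (int ^ 'n) set \<Rightarrow> (int ^ 'n) set \<Rightarrow> 'a set" where
  "boundary_algebra r s \<AA> p k H I =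
     BB s \<AA> p (Lambda_of r k H I) (Delta_of r s k H I)"

text \<open>The operator $\mathbb{E}_\Delta(x) \in \mathfrak{B}(I)$.\<close>

definition EE ::
  "nat \<Rightarrow> nat \<Rightarrow> ((int ^ 'n) set \<Rightarrow> 'a::unital_cstar_algebra set) \<Rightarrow>
   ((int ^ 'n) set \<Rightarrow> 'a) \<Rightarrow> 'n \<Rightarrow> (int ^ 'n) set \<Rightarrow> (int ^ 'n) set \<Rightarrow> (int ^ 'n) set \<Rightarrow>
   'a \<Rightarrow> 'a" where
  "EE r s \<AA> p k H I \<Delta> x =
     (THE y. y \<in> boundary_algebra r s \<AA> p k H I \<and> p \<Delta> * x * p \<Delta> = y * p \<Delta>)"

end

theory Submission
  imports Defs
begin

text \<open>
  Every $y \in \mathfrak{B}(I)$ commutes with $p_F$ for each $F$ surrounding $\Lambda_I$ along \<open>I\<close>.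
  Hence, for such an $F$ containing both $\Delta$ and $\Delta'$, compressing
  $p_\Delta x p_\Delta = y p_\Delta$ by $p_F$ gives $p_F x p_F = y p_F$, and likewise for $\Delta'$
  and $y'$; by (LTO4), $y p_F = y' p_F$ forces $y = y'$. The combinatorial input is that $\Lambda_I$ and
  $\Delta_I$ exist, that $\Delta_I$ lies in $\Delta$ and $\Delta'$, and that a common $F$ exists.
\<close>

text \<open>Existence of y: (LTO2) applies to \<open>\<Lambda>\<close>, whose algebra contains x,
  while B(I) is built on Lambda_I. (LTO3) exchanges the inner rectangle with \<open>\<Delta>\<close>
  kept fixed. The representative z obtained in this way commutes with the projection of every
  rectangle surrounding Lambda_I along \<open>I\<close>, a condition that mentions only Lambda_I and
  \<open>I\<close>; multiplied by the projection of Delta_I it therefore lies in B(I), and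
  p_\<Delta> absorbs that factor because Delta_I lies in \<open>\<Delta>\<close>. This containment
  shapes the geometry: Delta_I is least among rectangles surrounding Lambda_I, but
  \<open>\<Delta>\<close> is given as surrounding \<open>\<Lambda>\<close>. It is therefore proved
  for every sufficiently large inner rectangle with face \<open>I\<close>. Two facts drive it: in
  the half-space a rectangle is nowhere wider than its nonempty face in the sublattice, and a site
  of \<open>\<Lambda>\<close> off the sublattice is not on the boundary of \<open>\<Delta>\<close>,
  which forces \<open>\<Delta>\<close> to reach \<open>s\<close> sites beyond
  \<open>\<Lambda>\<close> there.\<close>

section \<open>Rectangles, boundary sites and the half-space\<close>

text \<open>A box is a product of intervals, so each coordinate may be tested with its own,
  unrelated witnesses. This is the form in which convexity is used throughout.\<close>

lemma rectangle_memI: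
  assumes "rectangle R" "\<And>i. \<exists>y\<in>R. y $ i \<le> x $ i" "\<And>i. \<exists>y\<in>R. x $ i \<le> y $ i"
  shows "x \<in> R"
proof -
  obtain a b where R: "R = {x. \<forall>i. a $ i \<le> x $ i \<and> x $ i \<le> b $ i}"
    using assms(1) by (auto simp: rectangle_def)
  have "a $ i \<le> x $ i \<and> x $ i \<le> b $ i" for i
    using assms(2)[of i] assms(3)[of i] unfolding R by (auto intro: order_trans)
  then show ?thesis
    by (simp add: R)
qed

lemma rectangle_coord_bounded:
  fixes R :: "(int ^ 'n) set"
  assumes "rectangle R"
  obtains N where "\<And>x i. x \<in> R \<Longrightarrow> \<bar>x $ i\<bar> \<le> N"
proof -
  obtain a b where R: "R = {x. \<forall>i. a $ i \<le> x $ i \<and> x $ i \<le> b $ i}"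
    using assms by (auto simp: rectangle_def)
  define N where "N = (\<Sum>i\<in>UNIV. \<bar>a $ i\<bar> + \<bar>b $ i\<bar>)"
  have "\<bar>x $ i\<bar> \<le> N" if "x \<in> R" for x i
  proof -
    have "\<bar>x $ i\<bar> \<le> \<bar>a $ i\<bar> + \<bar>b $ i\<bar>"
      using that unfolding R by (smt (verit) mem_Collect_eq)
    also have "\<dots> \<le> N"
      unfolding N_def by (rule member_le_sum) auto
    finally show ?thesis .
  qed
  then show ?thesis
    using that by blast
qed

lemma bdry_mono: "x \<in> bdry \<Delta> \<Longrightarrow> \<Lambda> \<subseteq> \<Delta> \<Longrightarrow> x \<in> \<Lambda> \<Longrightarrow> x \<in> bdry \<Lambda>"
  by (auto simp: bdry_def)

text \<open>In the half-space, 0 is an extreme value of the \<open>k\<close>-th coordinate. Hence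
  the boundary condition defining Lambda_I concerns simply the section of the rectangle by the
  sublattice.\<close>

lemma mem_bdry_coord_sublattice:
  assumes "\<sigma> = 1 \<or> \<sigma> = -1" "M \<subseteq> {x. 0 \<le> \<sigma> * x $ k}" "x \<in> M" "x $ k = 0"
  shows "x \<in> bdry M"
proof -
  have "(\<forall>y\<in>M. y $ k \<le> x $ k) \<or> (\<forall>y\<in>M. x $ k \<le> y $ k)"
    using assms(1,2,4) by auto
  then show ?thesis
    using assms(3) by (auto simp: bdry_def)
qed

lemma bdry_Int_coord_sublattice:
  assumes "\<sigma> = 1 \<or> \<sigma> = -1" "M \<subseteq> {x. 0 \<le> \<sigma> * x $ k}"
  shows "bdry M \<inter> coord_sublattice k = M \<inter> coord_sublattice k"
  using mem_bdry_coord_sublattice[OF assms] by (auto simp: coord_sublattice_def bdry_def)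

section \<open>Slabs standing on a face in the sublattice\<close>

text \<open>
  The sign \<open>\<sigma>\<close> selects the half-space, so that both are treated at once; the \<open>k\<close>-th coordinates
  of \<open>a\<close> and \<open>b\<close> are irrelevant.
\<close>

definition slab :: "int \<Rightarrow> 'n \<Rightarrow> int \<Rightarrow> int ^ 'n \<Rightarrow> int ^ 'n \<Rightarrow> (int ^ 'n) set" where
  "slab \<sigma> k h a b =
     {x. 0 \<le> \<sigma> * x $ k \<and> \<sigma> * x $ k \<le> h \<and> (\<forall>i. i \<noteq> k \<longrightarrow> a $ i \<le> x $ i \<and> x $ i \<le> b $ i)}"

lemma slab_eq_box:
  assumes "\<sigma> = 1 \<or> \<sigma> = -1"
  shows "slab \<sigma> k h a b =
    {x. \<forall>i. (\<chi> i. if i = k then (if \<sigma> = 1 then 0 else - h) else a $ i) $ i \<le> x $ i \<and>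
            x $ i \<le> (\<chi> i. if i = k then (if \<sigma> = 1 then h else 0) else b $ i) $ i}"
  using assms by (auto simp: slab_def split: if_splits)

lemma rectangle_slab: "\<sigma> = 1 \<or> \<sigma> = -1 \<Longrightarrow> rectangle (slab \<sigma> k h a b)"
  unfolding rectangle_def using slab_eq_box by blast

text \<open>A slab of height \<open>h\<close> has the layers 0 to \<open>h\<close>, that is
  \<open>h + 1\<close> of them, whence the \<open>+ 1\<close>. The cube is placed at the lowest
  corner, which has \<open>k\<close>-th coordinate \<open>- h\<close> on the negative side.\<close>

lemma sufficiently_large_slab:
  assumes "\<sigma> = 1 \<or> \<sigma> = -1" "int r \<le> h + 1" "\<And>i. i \<noteq> k \<Longrightarrow> a $ i + int r \<le> b $ i + 1"
  shows "sufficiently_large r (slab \<sigma> k h a b)"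
proof -
  define q where "q = (\<chi> i. if i = k then (if \<sigma> = 1 then 0 else - h) else a $ i)"
  have "{x. \<forall>i. q $ i \<le> x $ i \<and> x $ i < q $ i + int r} \<subseteq> slab \<sigma> k h a b"
    unfolding slab_eq_box[OF assms(1)]
  proof safe
    fix x i assume x: "\<forall>i. q $ i \<le> x $ i \<and> x $ i < q $ i + int r"
    show "(\<chi> i. if i = k then (if \<sigma> = 1 then 0 else - h) else a $ i) $ i \<le> x $ i"
      using x by (simp add: q_def)
    show "x $ i \<le> (\<chi> i. if i = k then (if \<sigma> = 1 then h else 0) else b $ i) $ i"
      using x[rule_format, of i] assms(2) assms(3)[of i] by (auto simp: q_def split: if_splits)
  qed
  then show ?thesis
    unfolding sufficiently_large_def cube_def by blast
qed

text \<open>The window of \<open>s\<close> sites starts at \<open>t\<close> if it fits there, and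
  otherwise is pushed against the right end.\<close>

lemma interval_of_length:
  fixes c d t :: int
  assumes "c \<le> t" "t \<le> d" "c + int s \<le> d + 1" "s > 0"
  shows "\<exists>q. c \<le> q \<and> q \<le> t \<and> t < q + int s \<and> q + int s \<le> d + 1"
proof (cases "t + int s \<le> d + 1")
  case True
  then show ?thesis using assms by (intro exI[of _ t]) auto
next
  case False
  then show ?thesis using assms by (intro exI[of _ "d + 1 - int s"]) auto
qed

text \<open>It suffices that the cube avoids the inner box in one coordinate \<open>j\<close> in
  which \<open>x\<close> does. The gap on that side has at least \<open>s\<close> sites; in all
  other directions the cube only has to stay in the outer box.\<close>

lemma cube_in_box_diff:
  fixes a b c d x :: "int ^ 'n"
  assumes "s > 0"
    and "\<And>i. c $ i = a $ i \<or> c $ i + int s \<le> a $ i"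
    and "\<And>i. d $ i = b $ i \<or> b $ i + int s \<le> d $ i"
    and "\<And>i. c $ i + int s \<le> d $ i + 1"
    and x: "\<And>i. c $ i \<le> x $ i \<and> x $ i \<le> d $ i"
    and "\<not> (\<forall>i. a $ i \<le> x $ i \<and> x $ i \<le> b $ i)"
  shows "\<exists>Q. cube s Q \<and> x \<in> Q \<and>
    Q \<subseteq> {x. \<forall>i. c $ i \<le> x $ i \<and> x $ i \<le> d $ i} - {x. \<forall>i. a $ i \<le> x $ i \<and> x $ i \<le> b $ i}"
proof -
  obtain j where j: "x $ j < a $ j \<or> b $ j < x $ j"
    using assms(6) by (auto simp: not_le)
  define P where "P i q \<longleftrightarrow> c $ i \<le> q \<and> q \<le> x $ i \<and> x $ i < q + int s \<and> q + int s \<le> d $ i + 1" for i q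
  \<comment> \<open>The \<open>j\<close>-th side of the cube goes into the gap. The inner box is not
    assumed to lie in the outer one, so \<open>min\<close> and \<open>max\<close> clip the gap to
    the outer interval.\<close>
  obtain t where t: "P j t" "t + int s \<le> a $ j \<or> b $ j < t"
  proof (cases "x $ j < a $ j")
    case True
    then have "c $ j + int s \<le> a $ j" using assms(2)[of j] x[of j] by auto
    then obtain q where "c $ j \<le> q" "q \<le> x $ j" "x $ j < q + int s" "q + int s \<le> min (a $ j - 1) (d $ j) + 1"
      using interval_of_length[of "c $ j" "x $ j" "min (a $ j - 1) (d $ j)" s] x[of j] True assms(1) assms(4)[of j]
      by fastforce
    then show ?thesis using that[of q] unfolding P_def by linarith
  next
    case False
    then have l: "b $ j < x $ j" using j by simp
    then have "b $ j + int s \<le> d $ j" using assms(3)[of j] x[of j] by auto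
    then obtain q where "max (b $ j + 1) (c $ j) \<le> q" "q \<le> x $ j" "x $ j < q + int s" "q + int s \<le> d $ j + 1"
      using interval_of_length[of "max (b $ j + 1) (c $ j)" "x $ j" "d $ j" s] x[of j] l assms(1) assms(4)[of j]
      by fastforce
    then show ?thesis using that[of q] by (auto simp: P_def)
  qed
  have "\<exists>q. P i q" for i
    unfolding P_def using interval_of_length x assms(1,4) by blast
  then obtain f where f: "\<And>i. P i (f i)"
    by metis
  define q where "q = (\<chi> i. if i = j then t else f i)"
  have q: "P i (q $ i)" for i
    using f t(1) by (simp add: q_def)
  let ?Q = "{y. \<forall>i. q $ i \<le> y $ i \<and> y $ i < q $ i + int s}"
  have "x \<in> ?Q"
    using q by (auto simp: P_def)
  moreover have "c $ i \<le> y $ i \<and> y $ i \<le> d $ i" if "y \<in> ?Q" for y i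
    using that q[of i] unfolding P_def by (smt (verit) mem_Collect_eq)
  moreover have "\<not> (a $ j \<le> y $ j \<and> y $ j \<le> b $ j)" if "y \<in> ?Q" for y
  proof -
    have "t \<le> y $ j \<and> y $ j < t + int s"
      using that by (auto simp: q_def dest: spec[of _ j])
    then show ?thesis using t(2) by auto
  qed
  moreover have "cube s ?Q"
    by (auto simp: cube_def)
  ultimately show ?thesis
    by (intro exI[of _ ?Q]) blast
qed

lemma surrounded_slab:
  assumes \<sigma>: "\<sigma> = 1 \<or> \<sigma> = -1" and "s > 0" "0 \<le> h" "h + int s \<le> h'"
    and ac: "\<And>i. i \<noteq> k \<Longrightarrow> c $ i + int s \<le> a $ i"
    and bd: "\<And>i. i \<noteq> k \<Longrightarrow> b $ i + int s \<le> d $ i"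
    and ne: "slab \<sigma> k 0 a b \<noteq> {}"
  shows "surrounded s (slab \<sigma> k h a b) (slab \<sigma> k h' c d)"
    and "bdry (slab \<sigma> k h a b) \<inter> bdry (slab \<sigma> k h' c d) = slab \<sigma> k 0 a b"
proof -
  have ab: "a $ i \<le> b $ i" if "i \<noteq> k" for i
    using ne that by (force simp: slab_def)
  have sub: "slab \<sigma> k h a b \<subseteq> slab \<sigma> k h' c d"
    using assms(2,4) ac bd by (force simp: slab_def)
  have H: "slab \<sigma> k h a b \<subseteq> {x. 0 \<le> \<sigma> * x $ k}" "slab \<sigma> k h' c d \<subseteq> {x. 0 \<le> \<sigma> * x $ k}"
    by (auto simp: slab_def)
  show I: "bdry (slab \<sigma> k h a b) \<inter> bdry (slab \<sigma> k h' c d) = slab \<sigma> k 0 a b"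
  proof (intro equalityI subsetI)
    fix x assume "x \<in> slab \<sigma> k 0 a b"
    moreover from this have "x $ k = 0"
      using \<sigma> by (auto simp: slab_def)
    moreover have "x \<in> slab \<sigma> k h a b"
      using calculation assms(3) by (auto simp: slab_def)
    ultimately show "x \<in> bdry (slab \<sigma> k h a b) \<inter> bdry (slab \<sigma> k h' c d)"
      using mem_bdry_coord_sublattice[OF \<sigma> H(1)] mem_bdry_coord_sublattice[OF \<sigma> H(2)] sub by blast
  next
    fix x assume x: "x \<in> bdry (slab \<sigma> k h a b) \<inter> bdry (slab \<sigma> k h' c d)"
    then have xs: "x \<in> slab \<sigma> k h a b" "x \<in> slab \<sigma> k h' c d"
      by (auto simp: bdry_def)
    obtain i where i: "(\<forall>y\<in>slab \<sigma> k h' c d. y $ i \<le> x $ i) \<or> (\<forall>y\<in>slab \<sigma> k h' c d. x $ i \<le> y $ i)"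
      using x by (auto simp: bdry_def)
    have [simp]: "i = k"
    \<comment> \<open>Laterally the outer slab exceeds the inner one by \<open>s > 0\<close> on both
      sides, so a site of the inner slab can be moved both ways and is not extreme.\<close>
    proof (rule ccontr)
      assume ik: "i \<noteq> k"
      then have *: "(\<chi> j. if j = i then t else x $ j) \<in> slab \<sigma> k h' c d" if "c $ i \<le> t" "t \<le> d $ i" for t
        using xs(2) that by (auto simp: slab_def)
      have "c $ i \<le> d $ i" "c $ i < x $ i" "x $ i < d $ i"
        using xs(1) ik ac[OF ik] bd[OF ik] ab[OF ik] \<open>s > 0\<close> by (force simp: slab_def)+
      then show False
        using i *[of "c $ i"] *[of "d $ i"] by force
    qed
    have *: "(\<chi> j. if j = k then \<sigma> * t else x $ j) \<in> slab \<sigma> k h' c d" if "0 \<le> t" "t \<le> h'" for t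
      using xs(2) that \<sigma> by (auto simp: slab_def)
    \<comment> \<open>\<open>?u t\<close> is \<open>x\<close> moved to layer \<open>t\<close>.
      Comparison with layers 0 and \<open>h'\<close> shows that \<open>x\<close> is in one of these,
      and layer \<open>h'\<close> is above the inner slab.\<close>
    let ?u = "\<lambda>t. \<chi> j. if j = k then \<sigma> * t else x $ j"
    have "?u 0 \<in> slab \<sigma> k h' c d" "?u h' \<in> slab \<sigma> k h' c d"
      using * assms(3,4) by simp_all
    then have "?u 0 $ k \<le> x $ k \<and> ?u h' $ k \<le> x $ k \<or> x $ k \<le> ?u 0 $ k \<and> x $ k \<le> ?u h' $ k"
      using i \<open>i = k\<close> by blast
    then have "h' \<le> \<sigma> * x $ k \<or> \<sigma> * x $ k \<le> 0"
      using \<sigma> by auto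
    then have "\<sigma> * x $ k = 0"
      using xs(1) assms(2,4) by (auto simp: slab_def)
    then show "x \<in> slab \<sigma> k 0 a b"
      using xs(1) by (auto simp: slab_def)
  qed
  have "\<exists>Q. cube s Q \<and> x \<in> Q \<and> Q \<subseteq> slab \<sigma> k h' c d - slab \<sigma> k h a b"
    if "x \<in> slab \<sigma> k h' c d - slab \<sigma> k h a b" for x
  proof -
    define lo hi where
      "lo h u = (\<chi> i. if i = k then (if \<sigma> = 1 then 0 else - h) else u $ i)" and
      "hi h u = (\<chi> i. if i = k then (if \<sigma> = 1 then h else 0) else u $ i)"
      for h and u :: "int ^ _"
    have box: "slab \<sigma> k h u v = {x. \<forall>i. lo h u $ i \<le> x $ i \<and> x $ i \<le> hi h v $ i}" for h u v
      unfolding lo_def hi_def by (rule slab_eq_box[OF \<sigma>])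
    show ?thesis
      unfolding box
    proof (rule cube_in_box_diff)
      fix i
      show "lo h' c $ i = lo h a $ i \<or> lo h' c $ i + int s \<le> lo h a $ i"
        using assms(4) ac[of i] by (auto simp: lo_def)
      show "hi h' d $ i = hi h b $ i \<or> hi h b $ i + int s \<le> hi h' d $ i"
        using assms(4) bd[of i] by (auto simp: hi_def)
      show "lo h' c $ i + int s \<le> hi h' d $ i + 1"
        using assms(3,4) ac[of i] bd[of i] ab[of i] by (auto simp: lo_def hi_def)
      show "lo h' c $ i \<le> x $ i \<and> x $ i \<le> hi h' d $ i"
        using that unfolding box by blast
    next
      show "\<not> (\<forall>i. lo h a $ i \<le> x $ i \<and> x $ i \<le> hi h b $ i)"
        using that unfolding box by blast
    qed (rule \<open>s > 0\<close>)
  qed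
  moreover have "codim1_rectangle (slab \<sigma> k 0 a b)"
  proof -
    have "\<forall>x\<in>slab \<sigma> k 0 a b. x $ k = 0"
      using \<sigma> by (auto simp: slab_def)
    then show ?thesis
      using ne rectangle_slab[OF \<sigma>] unfolding codim1_rectangle_def by blast
  qed
  ultimately show "surrounded s (slab \<sigma> k h a b) (slab \<sigma> k h' c d)"
    using sub I rectangle_slab[OF \<sigma>] by (auto simp: surrounded_def)
qed

section \<open>What rectangles in the half-space are forced to contain\<close>

text \<open>By convexity one high site is enough: across the sublattice, \<open>x\<close> lies
  between its projection \<open>?z\<close> and \<open>y\<close>; in the other directions it agrees
  with \<open>?z\<close>.\<close>

lemma slab_subsetI:
  assumes "\<sigma> = 1 \<or> \<sigma> = -1" "rectangle M" "slab \<sigma> k 0 a b \<subseteq> M" "y \<in> M" "h \<le> \<sigma> * y $ k"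
  shows "slab \<sigma> k h a b \<subseteq> M"
proof
  fix x assume x: "x \<in> slab \<sigma> k h a b"
  let ?z = "\<chi> i. if i = k then 0 else x $ i"
  have z: "?z \<in> M"
    using x assms(3) by (auto simp: slab_def)
  show "x \<in> M"
  proof (rule rectangle_memI[OF assms(2)])
    fix i
    have "(\<exists>y\<in>M. y $ i \<le> x $ i) \<and> (\<exists>y\<in>M. x $ i \<le> y $ i)"
    proof (cases "i = k")
      case True
      have "?z $ k = 0" "0 \<le> \<sigma> * x $ k" "\<sigma> * x $ k \<le> \<sigma> * y $ k"
        using x assms(5) by (auto simp: slab_def)
      then show ?thesis
        using z assms(1,4) True by (metis minus_le_iff minus_minus mult_1 mult_minus1 neg_0_le_iff_le neg_le_iff_le)
    next
      case False
      then have "?z $ i = x $ i"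
        by simp
      then show ?thesis
        using z by (metis order_refl)
    qed
    then show "\<exists>y\<in>M. y $ i \<le> x $ i" "\<exists>y\<in>M. x $ i \<le> y $ i"
      by blast+
  qed
qed

text \<open>Since \<open>M\<close> is a box that meets the sublattice, setting the
  \<open>k\<close>-th coordinate of \<open>y\<close> to 0 stays in \<open>M\<close> and lands in the
  section.\<close>

lemma section_bounds:
  assumes "\<sigma> = 1 \<or> \<sigma> = -1" "rectangle M" "M \<inter> coord_sublattice k = slab \<sigma> k 0 a b" "slab \<sigma> k 0 a b \<noteq> {}"
    and "y \<in> M" "i \<noteq> k"
  shows "a $ i \<le> y $ i" "y $ i \<le> b $ i"
proof -
  obtain z where z: "z \<in> M" "z $ k = 0"
    using assms(3,4) by (auto simp: coord_sublattice_def)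
  let ?w = "\<chi> i. if i = k then 0 else y $ i"
  have "?w \<in> M"
    by (rule rectangle_memI[OF assms(2)]) (use z assms(5) in force)+
  then have "?w \<in> M \<inter> coord_sublattice k"
    by (simp add: coord_sublattice_def)
  then have "?w \<in> slab \<sigma> k 0 a b"
    unfolding assms(3) .
  then show "a $ i \<le> y $ i" "y $ i \<le> b $ i"
    using assms(6) by (auto simp: slab_def)
qed

text \<open>Opposite corners of an \<open>r\<close>-cube differ by \<open>r - 1\<close> in each
  coordinate. Laterally both lie over the section; across the sublattice both are on the same side,
  so the farther one has height at least \<open>r - 1\<close>.\<close>

lemma sufficiently_large_section:
  assumes \<sigma>: "\<sigma> = 1 \<or> \<sigma> = -1" and M: "rectangle M" "M \<subseteq> {x. 0 \<le> \<sigma> * x $ k}"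
    and sec: "M \<inter> coord_sublattice k = slab \<sigma> k 0 a b" "slab \<sigma> k 0 a b \<noteq> {}"
    and "r > 0" "sufficiently_large r M"
  shows "i \<noteq> k \<Longrightarrow> a $ i + int r \<le> b $ i + 1" and "\<exists>y\<in>M. int r - 1 \<le> \<sigma> * y $ k"
proof -
  obtain q where q: "{x. \<forall>i. q $ i \<le> x $ i \<and> x $ i < q $ i + int r} \<subseteq> M"
    using assms(7) by (auto simp: sufficiently_large_def cube_def)
  let ?u = "\<chi> i. q $ i + int r - 1"
  have q1: "q \<in> M" and q2: "?u \<in> M"
    using q assms(6) by auto
  show "a $ i + int r \<le> b $ i + 1" if "i \<noteq> k"
    using section_bounds[OF \<sigma> M(1) sec q1 that] section_bounds[OF \<sigma> M(1) sec q2 that] by simp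
  have "0 \<le> \<sigma> * q $ k" "0 \<le> \<sigma> * ?u $ k"
    using q1 q2 M(2) by blast+
  then have "int r - 1 \<le> \<sigma> * q $ k \<or> int r - 1 \<le> \<sigma> * ?u $ k"
    using \<sigma> by auto
  then show "\<exists>y\<in>M. int r - 1 \<le> \<sigma> * y $ k"
    using q1 q2 by blast
qed

text \<open>
  The neighbour of \<open>m\<close> outside \<open>M\<close> in direction \<open>i\<close> lies in a cube avoiding \<open>M\<close>, hence avoiding
  \<open>m\<close>, so this cube extends away from \<open>M\<close>.
\<close>

lemma surrounded_extend:
  assumes \<tau>: "\<tau> = 1 \<or> \<tau> = -1" and "surrounded s M E" "m \<in> M" "m \<notin> bdry E"
    and ext: "\<And>y. y \<in> M \<Longrightarrow> \<tau> * y $ i \<le> \<tau> * m $ i"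
  shows "\<exists>e\<in>E. e $ i = m $ i + \<tau> * int s"
proof -
  have E: "rectangle E" "M \<subseteq> E" and cubes: "\<forall>x \<in> E - M. \<exists>Q. cube s Q \<and> x \<in> Q \<and> Q \<subseteq> E - M"
    using assms(2) by (auto simp: surrounded_def)
  have mE: "m \<in> E"
    using assms(3) E(2) by blast
  then obtain e where e: "e \<in> E" "\<tau> * m $ i < \<tau> * e $ i"
    using assms(4) \<tau> unfolding bdry_def by (auto simp: not_le dest!: spec[of _ i])
  define w where "w = (\<chi> j. if j = i then m $ i + \<tau> else m $ j)"
  have "w \<in> E"
    by (rule rectangle_memI[OF E(1)]; rename_tac j; case_tac "j = i")
       (use mE e \<tau> in \<open>force simp: w_def\<close>)+
  moreover have "w \<notin> M"
    using ext[of w] \<tau> by (auto simp: w_def)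
  ultimately obtain q where Q: "w \<in> {y. \<forall>i. q $ i \<le> y $ i \<and> y $ i < q $ i + int s}"
      "{y. \<forall>i. q $ i \<le> y $ i \<and> y $ i < q $ i + int s} \<subseteq> E - M"
    using cubes unfolding cube_def by blast
  have qj: "q $ j \<le> m $ j \<and> m $ j < q $ j + int s" if "j \<noteq> i" for j
    using Q(1) that by (auto simp: w_def dest: spec[of _ j])
  have qi: "q $ i \<le> m $ i + \<tau> \<and> m $ i + \<tau> < q $ i + int s"
    using Q(1) by (auto simp: w_def dest: spec[of _ i])
  have "m \<notin> {y. \<forall>i. q $ i \<le> y $ i \<and> y $ i < q $ i + int s}"
    using Q(2) assms(3) by blast
  then have "\<not> (q $ i \<le> m $ i \<and> m $ i < q $ i + int s)"
    using qj by force
  \<comment> \<open>The \<open>i\<close>-th side of the cube contains \<open>m $ i + \<tau>\<close>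
    but not \<open>m $ i\<close>, so it begins right next to \<open>m\<close> and its last site is
    exactly \<open>s\<close> steps away.\<close>
  then have *: "q $ i \<le> m $ i + \<tau> * int s \<and> m $ i + \<tau> * int s < q $ i + int s"
    using qi \<tau> by auto
  let ?e = "\<chi> j. if j = i then m $ i + \<tau> * int s else m $ j"
  have "?e \<in> {y. \<forall>i. q $ i \<le> y $ i \<and> y $ i < q $ i + int s}"
    using * qj by auto
  then show ?thesis
    using Q(2) by (intro bexI[of _ ?e]) (simp, blast)
qed

text \<open>A boundary site of \<open>E\<close> in \<open>M\<close> is also one of \<open>M\<close>,
  hence lies in the common face. So \<open>surrounded_extend\<close> applies at every site of
  \<open>M\<close> off the sublattice, and \<open>0 < h\<close> provides such sites above the whole
  face.\<close>

lemma slab_subset_surrounding: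
  assumes \<sigma>: "\<sigma> = 1 \<or> \<sigma> = -1" and M: "rectangle M" "M \<subseteq> {x. 0 \<le> \<sigma> * x $ k}"
    and sec: "M \<inter> coord_sublattice k = slab \<sigma> k 0 a b" "slab \<sigma> k 0 a b \<noteq> {}"
    and y: "y \<in> M" "0 < h" "h \<le> \<sigma> * y $ k"
    and E: "surrounded s M E" "bdry M \<inter> bdry E = slab \<sigma> k 0 a b"
  shows "slab \<sigma> k (h + int s) (\<chi> i. a $ i - int s) (\<chi> i. b $ i + int s) \<subseteq> E"
proof
  fix x assume x: "x \<in> slab \<sigma> k (h + int s) (\<chi> i. a $ i - int s) (\<chi> i. b $ i + int s)"
  have ab: "a $ i \<le> b $ i" if "i \<noteq> k" for i
    using sec(2) that by (force simp: slab_def)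
  have IM: "slab \<sigma> k 0 a b \<subseteq> M"
    using sec(1) by blast
  have rE: "rectangle E" and ME: "M \<subseteq> E"
    using E(1) by (auto simp: surrounded_def)
  have hM: "slab \<sigma> k h a b \<subseteq> M"
    by (rule slab_subsetI[OF \<sigma> M(1) IM y(1) y(3)])
  have out: "m \<notin> bdry E" if "m \<in> M" "m $ k \<noteq> 0" for m
  proof
    assume "m \<in> bdry E"
    then have "m \<in> slab \<sigma> k 0 a b"
      using E(2) bdry_mono[OF _ ME that(1)] by blast
    then show False
      using that(2) \<sigma> by (auto simp: slab_def)
  qed
  \<comment> \<open>\<open>M\<close> may be higher than \<open>h\<close>, and extension starts only
    from a site extreme in \<open>M\<close>; hence the choice of a topmost site.\<close>
  obtain t where t: "t \<in> M" "\<And>z. z \<in> M \<Longrightarrow> \<sigma> * z $ k \<le> \<sigma> * t $ k"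
  proof -
    obtain a' b' where M': "M = {x. \<forall>i. a' $ i \<le> x $ i \<and> x $ i \<le> b' $ i}"
      using M(1) by (auto simp: rectangle_def)
    have "a' \<in> M" "b' \<in> M"
      using y(1) unfolding M' by (auto intro: order_trans)
    then show ?thesis
      using \<sigma> that[of a'] that[of b'] unfolding M' by auto
  qed
  show "x \<in> E"
  proof (rule rectangle_memI[OF rE])
    fix i
    have "(\<exists>e\<in>E. e $ i \<le> x $ i) \<and> (\<exists>e\<in>E. x $ i \<le> e $ i)"
    proof (cases "i = k")
      case True
      have "t $ k \<noteq> 0"
        using t(2)[OF y(1)] y(2,3) by auto
      then obtain e where e: "e \<in> E" "e $ k = t $ k + \<sigma> * int s"
        using surrounded_extend[OF \<sigma> E(1) t(1) out[OF t(1)] t(2)] by blast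
      have "h + int s \<le> \<sigma> * e $ k"
        using t(2)[OF y(1)] y(3) e(2) \<sigma> by auto
      moreover obtain z where z: "z \<in> E" "z $ k = 0"
        using sec ME by (auto simp: coord_sublattice_def)
      moreover have "0 \<le> \<sigma> * x $ k" "\<sigma> * x $ k \<le> h + int s"
        using x by (auto simp: slab_def)
      ultimately have "z $ k \<le> x $ k \<and> x $ k \<le> e $ k \<or> e $ k \<le> x $ k \<and> x $ k \<le> z $ k"
        using \<sigma> by auto
      then show ?thesis
        using z(1) e(1) True by blast
    next
      case False
      \<comment> \<open>The corners \<open>a\<close> and \<open>b\<close> of the face are lifted to
        height \<open>h\<close>: they leave the boundary of \<open>E\<close> but remain extreme in
        \<open>M\<close> in direction \<open>i\<close>.\<close>
      define m where "m v = (\<chi> j. if j = k then \<sigma> * h else (v :: int ^ _) $ j)" for v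
      have m: "m v \<in> M" "m v \<notin> bdry E" "m v $ i = v $ i" if "v = a \<or> v = b" for v
      proof -
        have "m v \<in> slab \<sigma> k h a b"
          using that ab \<sigma> y(2) by (auto simp: m_def slab_def)
        then show "m v \<in> M" "m v \<notin> bdry E"
          using hM out[of "m v"] y(2) \<sigma> by (auto simp: m_def)
        show "m v $ i = v $ i"
          using False by (simp add: m_def)
      qed
      have "\<exists>e\<in>E. e $ i = m a $ i + (-1) * int s"
        by (rule surrounded_extend[OF _ E(1) m(1,2)])
           (use section_bounds[OF \<sigma> M(1) sec _ False] m(3) in auto)
      moreover have "\<exists>e\<in>E. e $ i = m b $ i + 1 * int s"
        by (rule surrounded_extend[OF _ E(1) m(1,2)])
           (use section_bounds[OF \<sigma> M(1) sec _ False] m(3) in auto)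
      moreover have "m a $ i - int s \<le> x $ i" "x $ i \<le> m b $ i + int s"
        using x m(3) False by (auto simp: slab_def)
      ultimately show ?thesis
        by (smt (verit) mult_1 mult_minus1)
    qed
    then show "\<exists>e\<in>E. e $ i \<le> x $ i" "\<exists>e\<in>E. x $ i \<le> e $ i"
      by blast+
  qed
qed

section \<open>The rectangles Lambda_I and Delta_I, and a common larger one\<close>

lemma half_space_sign:
  assumes "half_space k H"
  obtains \<sigma> :: int where "\<sigma> = 1 \<or> \<sigma> = -1" "H = {x. 0 \<le> \<sigma> * x $ k}"
proof -
  consider "H = {x. x $ k \<ge> 0}" | "H = {x. x $ k \<le> 0}"
    using assms by (auto simp: half_space_def)
  then show ?thesis
    by cases (use that[of 1] that[of "-1"] in auto)
qed

text \<open>Translates \<open>I\<close>, which is given through \<open>\<Delta>\<close>, into a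
  property of \<open>\<Lambda>\<close> alone.\<close>

lemma section_eq_common_bdry:
  assumes \<sigma>: "\<sigma> = 1 \<or> \<sigma> = -1" and "\<Lambda> \<subseteq> \<Delta>" "\<Delta> \<subseteq> {x. 0 \<le> \<sigma> * x $ k}"
    and "bdry \<Lambda> \<inter> bdry \<Delta> \<subseteq> coord_sublattice k"
  shows "\<Lambda> \<inter> coord_sublattice k = bdry \<Lambda> \<inter> bdry \<Delta>"
proof -
  have "x \<in> bdry \<Lambda> \<inter> bdry \<Delta>" if "x \<in> \<Lambda>" "x $ k = 0" for x
    using that assms(2,3) bdry_mono mem_bdry_coord_sublattice[OF \<sigma> assms(3)] by blast
  moreover have "bdry \<Lambda> \<subseteq> \<Lambda>"
    by (auto simp: bdry_def)
  ultimately show ?thesis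
    using assms(4) unfolding coord_sublattice_def by blast
qed

lemma rectangle_in_coord_sublattice_eq_slab:
  assumes "\<sigma> = 1 \<or> \<sigma> = -1" "rectangle I" "I \<subseteq> coord_sublattice k" "I \<noteq> {}"
  obtains a b where "I = slab \<sigma> k 0 a b"
proof -
  obtain a b where I: "I = {x. \<forall>i. a $ i \<le> x $ i \<and> x $ i \<le> b $ i}"
    using assms(2) by (auto simp: rectangle_def)
  obtain z where z: "z \<in> I" "z $ k = 0"
    using assms(3,4) by (auto simp: coord_sublattice_def)
  have "x \<in> I \<longleftrightarrow> x \<in> slab \<sigma> k 0 a b" for x
  proof
    assume x: "x \<in> I"
    then have "x $ k = 0"
      using assms(3) by (auto simp: coord_sublattice_def)
    with x show "x \<in> slab \<sigma> k 0 a b"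
      unfolding I by (simp add: slab_def)
  next
    assume x: "x \<in> slab \<sigma> k 0 a b"
    then have "x $ k = z $ k"
      using z(2) assms(1) by (auto simp: slab_def)
    moreover have "a $ k \<le> z $ k" "z $ k \<le> b $ k"
      using z(1) by (auto simp: I)
    ultimately have "a $ i \<le> x $ i \<and> x $ i \<le> b $ i" for i
      using x by (cases "i = k") (auto simp: slab_def)
    then show "x \<in> I"
      by (simp add: I)
  qed
  then show ?thesis
    using that by blast
qed

lemma slab_Int_coord_sublattice:
  assumes "\<sigma> = 1 \<or> \<sigma> = -1" "0 \<le> h"
  shows "slab \<sigma> k h a b \<inter> coord_sublattice k = slab \<sigma> k 0 a b"
  using assms by (auto simp: slab_def coord_sublattice_def)

text \<open>Lambda_I is \<open>I\<close> thickened to \<open>r\<close> layers: any competitor has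
  face \<open>I\<close> and reaches height \<open>r - 1\<close>, so it contains this slab by
  convexity.\<close>

lemma Lambda_of_eq_slab:
  assumes \<sigma>: "\<sigma> = 1 \<or> \<sigma> = -1" and "r > 0"
    and large: "\<And>i. i \<noteq> k \<Longrightarrow> a $ i + int r \<le> b $ i + 1" and ne: "slab \<sigma> k 0 a b \<noteq> {}"
  shows "Lambda_of r k {x. 0 \<le> \<sigma> * x $ k} (slab \<sigma> k 0 a b) = slab \<sigma> k (int r - 1) a b"
  unfolding Lambda_of_def
proof (rule Least_equality)
  let ?H = "{x. 0 \<le> \<sigma> * x $ k}" and ?L = "slab \<sigma> k (int r - 1) a b"
  have LH: "?L \<subseteq> ?H"
    by (auto simp: slab_def)
  have "bdry ?L \<inter> coord_sublattice k = slab \<sigma> k 0 a b"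
    unfolding bdry_Int_coord_sublattice[OF \<sigma> LH]
    using slab_Int_coord_sublattice[OF \<sigma>, of "int r - 1"] \<open>r > 0\<close> by simp
  moreover have "sufficiently_large r ?L"
    using sufficiently_large_slab[OF \<sigma> _ large] by simp
  ultimately show "rectangle ?L \<and> sufficiently_large r ?L \<and> ?L \<subseteq> ?H \<and>
      bdry ?L \<inter> coord_sublattice k = slab \<sigma> k 0 a b"
    using rectangle_slab[OF \<sigma>] LH by blast
  fix M
  assume M: "rectangle M \<and> sufficiently_large r M \<and> M \<subseteq> ?H \<and>
      bdry M \<inter> coord_sublattice k = slab \<sigma> k 0 a b"
  then have sec: "M \<inter> coord_sublattice k = slab \<sigma> k 0 a b"
    using bdry_Int_coord_sublattice[OF \<sigma>] by blast
  obtain y where "y \<in> M" "int r - 1 \<le> \<sigma> * y $ k"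
    using sufficiently_large_section(2)[OF \<sigma> _ _ sec ne \<open>r > 0\<close>] M by blast
  then show "?L \<subseteq> M"
    using slab_subsetI[OF \<sigma>] M sec by blast
qed

text \<open>
  For \<open>r = 1\<close> the rectangle $\Lambda_I$ is \<open>I\<close> itself, and then so is $\Delta_I$; for \<open>r > 1\<close> the far
  face of $\Lambda_I$ forces $\Delta_I$ to exceed it by \<open>s\<close> sites in all directions but one.
\<close>

lemma Delta_of_slab:
  assumes \<sigma>: "\<sigma> = 1 \<or> \<sigma> = -1" and "r > 0" "s > 0"
    and large: "\<And>i. i \<noteq> k \<Longrightarrow> a $ i + int r \<le> b $ i + 1" and ne: "slab \<sigma> k 0 a b \<noteq> {}"
  defines "H \<equiv> {x. 0 \<le> \<sigma> * x $ k}" and "I \<equiv> slab \<sigma> k 0 a b" and "L \<equiv> slab \<sigma> k (int r - 1) a b"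
  defines "D \<equiv> Delta_of r s k H I"
  shows "surrounded s L D" and "bdry L \<inter> bdry D = I"
    and "\<lbrakk>rectangle M; sufficiently_large r M; M \<subseteq> H; M \<inter> coord_sublattice k = I;
          surrounded s M E; bdry M \<inter> bdry E = I\<rbrakk> \<Longrightarrow> D \<subseteq> E"
proof -
  define D' where "D' = (if r = 1 then I else slab \<sigma> k (int r - 1 + int s) (\<chi> i. a $ i - int s) (\<chi> i. b $ i + int s))"
  have L: "Lambda_of r k H I = L"
    unfolding H_def I_def L_def using Lambda_of_eq_slab[OF \<sigma> \<open>r > 0\<close> large ne] .
  have secL: "L \<inter> coord_sublattice k = I"
    unfolding I_def L_def using slab_Int_coord_sublattice[OF \<sigma>, of "int r - 1"] \<open>r > 0\<close> by simp
  have LH: "rectangle L" "L \<subseteq> H" "sufficiently_large r L"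
    unfolding L_def H_def using rectangle_slab[OF \<sigma>] sufficiently_large_slab[OF \<sigma> _ large, of "int r - 1"]
    by (blast, auto simp: slab_def)
  have D': "surrounded s L D' \<and> bdry L \<inter> bdry D' = I"
  proof (cases "r = 1")
    case True
    have I0: "x $ k = 0" if "x \<in> I" for x
      using that \<sigma> by (auto simp: I_def slab_def)
    have [simp]: "L = I" "D' = I"
      using True by (auto simp: L_def I_def D'_def)
    \<comment> \<open>\<open>I\<close> is flat in direction \<open>k\<close>, so all its sites are
      boundary sites; the cube condition for \<open>I\<close> inside itself is vacuous.\<close>
    have "I \<subseteq> bdry I"
      using mem_bdry_coord_sublattice[OF \<sigma>, of I k] LH(2) I0 unfolding H_def \<open>L = I\<close> by blast
    then have [simp]: "bdry I = I"
      by (auto simp: bdry_def)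
    show ?thesis
      using I0 ne LH(1) by (auto simp: surrounded_def codim1_rectangle_def I_def[symmetric])
  next
    case False
    then show ?thesis
      using surrounded_slab[OF \<sigma> \<open>s > 0\<close> _ _ _ _ ne, of "int r - 1" "int r - 1 + int s"] \<open>r > 0\<close>
      by (simp add: D'_def L_def I_def)
  qed
  \<comment> \<open>\<open>M\<close> is kept general: \<open>M = L\<close> makes \<open>D'\<close>
    least, while the main proof takes \<open>\<Lambda>\<close> for \<open>M\<close>.\<close>
  have min: "D' \<subseteq> E" if M: "rectangle M" "sufficiently_large r M" "M \<subseteq> H" "M \<inter> coord_sublattice k = I"
    and E: "surrounded s M E" "bdry M \<inter> bdry E = I" for M E
  proof (cases "r = 1")
    case True
    have "I \<subseteq> E"
      using E by (auto simp: bdry_def)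
    then show ?thesis
      using True by (simp add: D'_def)
  next
    case False
    obtain y where y: "y \<in> M" "int r - 1 \<le> \<sigma> * y $ k"
      using sufficiently_large_section(2)[OF \<sigma> M(1) M(3)[unfolded H_def] M(4)[unfolded I_def] ne \<open>r > 0\<close> M(2)]
      by blast
    have "0 < int r - 1"
      using False \<open>r > 0\<close> by simp
    from slab_subset_surrounding[OF \<sigma> M(1) M(3)[unfolded H_def] M(4)[unfolded I_def] ne y(1) this y(2) E(1)
        E(2)[unfolded I_def]]
    show ?thesis
      using False by (simp add: D'_def)
  qed
  have "D = D'"
    unfolding D_def Delta_of_def L
  proof (rule Least_equality)
    have "D' \<subseteq> H"
      by (auto simp: D'_def I_def H_def slab_def)
    then show "rectangle D' \<and> D' \<subseteq> H \<and> surrounded s L D' \<and> bdry L \<inter> bdry D' = I"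
      using D' by (auto simp: surrounded_def)
  qed (use min LH secL in blast)
  then show "surrounded s L D" "bdry L \<inter> bdry D = I"
    and "\<lbrakk>rectangle M; sufficiently_large r M; M \<subseteq> H; M \<inter> coord_sublattice k = I;
          surrounded s M E; bdry M \<inter> bdry E = I\<rbrakk> \<Longrightarrow> D \<subseteq> E"
    using D' min by auto
qed

lemma large_surrounding_slab:
  assumes \<sigma>: "\<sigma> = 1 \<or> \<sigma> = -1" and "s > 0" "0 \<le> h" "slab \<sigma> k 0 a b \<noteq> {}" "rectangle E" "rectangle E'"
    and sub: "E \<subseteq> {x. 0 \<le> \<sigma> * x $ k}" "E' \<subseteq> {x. 0 \<le> \<sigma> * x $ k}"
  obtains F where "E \<subseteq> F" "E' \<subseteq> F" "surrounded s (slab \<sigma> k h a b) F"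
    "bdry (slab \<sigma> k h a b) \<inter> bdry F = slab \<sigma> k 0 a b"
proof -
  obtain N\<^sub>1 where N\<^sub>1: "\<And>x i. x \<in> E \<Longrightarrow> \<bar>x $ i\<bar> \<le> N\<^sub>1"
    using rectangle_coord_bounded[OF assms(5)] by blast
  obtain N\<^sub>2 where N\<^sub>2: "\<And>x i. x \<in> E' \<Longrightarrow> \<bar>x $ i\<bar> \<le> N\<^sub>2"
    using rectangle_coord_bounded[OF assms(6)] by blast
  \<comment> \<open>All summands are nonnegative, so \<open>N\<close> bounds the coordinates of both
    rectangles and at the same time leaves a margin of \<open>s\<close> around the inner
    slab.\<close>
  define N where "N = \<bar>N\<^sub>1\<bar> + \<bar>N\<^sub>2\<bar> + h + int s + (\<Sum>i\<in>UNIV. \<bar>a $ i\<bar> + \<bar>b $ i\<bar>)"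
  have ab: "\<bar>a $ i\<bar> + \<bar>b $ i\<bar> \<le> (\<Sum>i\<in>UNIV. \<bar>a $ i\<bar> + \<bar>b $ i\<bar>)" for i
    by (rule member_le_sum) auto
  have pos: "0 \<le> (\<Sum>i\<in>UNIV. \<bar>a $ i\<bar> + \<bar>b $ i\<bar>)"
    by (simp add: sum_nonneg)
  have in_F: "x \<in> slab \<sigma> k N (\<chi> i. - N) (\<chi> i. N)"
    if "0 \<le> \<sigma> * x $ k" and x: "\<And>i. \<bar>x $ i\<bar> \<le> \<bar>N\<^sub>1\<bar> + \<bar>N\<^sub>2\<bar>" for x
  proof -
    have *: "- N \<le> x $ i \<and> x $ i \<le> N" for i
      using x[of i] pos assms(3) unfolding N_def by linarith
    then show ?thesis
      using that(1) minus_le_iff[of N "x $ k"] \<sigma> by (auto simp: slab_def)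
  qed
  have EF: "E \<subseteq> slab \<sigma> k N (\<chi> i. - N) (\<chi> i. N)"
  proof
    fix x assume x: "x \<in> E"
    show "x \<in> slab \<sigma> k N (\<chi> i. - N) (\<chi> i. N)"
    proof (rule in_F)
      show "0 \<le> \<sigma> * x $ k"
        using sub(1) x by blast
      show "\<bar>x $ i\<bar> \<le> \<bar>N\<^sub>1\<bar> + \<bar>N\<^sub>2\<bar>" for i
        using N\<^sub>1[OF x, of i] by linarith
    qed
  qed
  have EF': "E' \<subseteq> slab \<sigma> k N (\<chi> i. - N) (\<chi> i. N)"
  proof
    fix x assume x: "x \<in> E'"
    show "x \<in> slab \<sigma> k N (\<chi> i. - N) (\<chi> i. N)"
    proof (rule in_F)
      show "0 \<le> \<sigma> * x $ k"
        using sub(2) x by blast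
      show "\<bar>x $ i\<bar> \<le> \<bar>N\<^sub>1\<bar> + \<bar>N\<^sub>2\<bar>" for i
        using N\<^sub>2[OF x, of i] by linarith
    qed
  qed
  have hN: "h + int s \<le> N"
    using pos unfolding N_def by linarith
  have "(\<chi> i. - N) $ i + int s \<le> a $ i" "b $ i + int s \<le> (\<chi> i. N) $ i" for i
    using ab[of i] assms(3) unfolding N_def by auto
  then show ?thesis
    using that[OF EF EF'] surrounded_slab[OF \<sigma> assms(2,3) hN _ _ assms(4)] by simp
qed

section \<open>Boundary algebras and independence of the outer rectangle\<close>

text \<open>(LTO4) only speaks of elements annihilated by a projection; closure under differences
  turns it into injectivity. The commutation condition is linear, so it passes to
  differences.\<close>

lemma BB_diff:
  assumes "cstar_subalgebra (\<AA> \<Lambda>)" "u \<in> BB s \<AA> p \<Lambda> \<Delta>" "v \<in> BB s \<AA> p \<Lambda> \<Delta>"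
  shows "u - v \<in> BB s \<AA> p \<Lambda> \<Delta>"
proof -
  let ?P = "\<lambda>z. \<forall>\<Delta>'. surrounded s \<Lambda> \<Delta>' \<and> bdry \<Lambda> \<inter> bdry \<Delta>' = bdry \<Lambda> \<inter> bdry \<Delta> \<longrightarrow> z * p \<Delta>' = p \<Delta>' * z"
  obtain c d where c: "c \<in> \<AA> \<Lambda>" "u = p \<Lambda> * c * p \<Lambda> * p \<Delta>" "?P (p \<Lambda> * c * p \<Lambda>)"
    and d: "d \<in> \<AA> \<Lambda>" "v = p \<Lambda> * d * p \<Lambda> * p \<Delta>" "?P (p \<Lambda> * d * p \<Lambda>)"
    using assms(2,3) by (auto simp: BB_def corner_def)
  have "(-1) *\<^sub>C d = - d"
    using scaleC_of_real[of "-1" d] by simp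
  then have "c - d \<in> \<AA> \<Lambda>"
    using assms(1) c(1) d(1) unfolding cstar_subalgebra_def by (metis diff_conv_add_uminus)
  moreover have e: "p \<Lambda> * (c - d) * p \<Lambda> = p \<Lambda> * c * p \<Lambda> - p \<Lambda> * d * p \<Lambda>"
    by (simp add: algebra_simps)
  moreover have "?P (p \<Lambda> * (c - d) * p \<Lambda>)"
    unfolding e using c(3) d(3) by (simp add: left_diff_distrib right_diff_distrib)
  moreover have "u - v = p \<Lambda> * (c - d) * p \<Lambda> * p \<Delta>"
    unfolding e c(2) d(2) by (simp add: left_diff_distrib)
  ultimately show ?thesis
    unfolding BB_def corner_def by blast
qed

lemma net_of_projections_absorb:
  assumes "net_of_projections \<AA> p" "rectangle \<Lambda>" "rectangle \<Delta>" "\<Lambda> \<subseteq> \<Delta>"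
  shows "p \<Delta> * p \<Lambda> = p \<Delta>" and "p \<Lambda> * p \<Delta> = p \<Delta>"
proof -
  show *: "p \<Delta> * p \<Lambda> = p \<Delta>"
    using assms by (auto simp: net_of_projections_def projection_le_def)
  have "star (p \<Delta>) = p \<Delta>" "star (p \<Lambda>) = p \<Lambda>"
    using assms by (auto simp: net_of_projections_def projection_def)
  then show "p \<Lambda> * p \<Delta> = p \<Delta>"
    using * star_mult[of "p \<Delta>" "p \<Lambda>"] by simp
qed

text \<open>With \<open>y = z * p D\<close> and \<open>z\<close> commuting with \<open>p E\<close>,
  both products equal \<open>z * p E\<close>, since \<open>p E\<close> absorbs \<open>p D\<close>
  from either side.\<close>

lemma BB_commute:
  assumes "net_of_projections \<AA> p" "rectangle D" "D \<subseteq> E" "surrounded s \<Lambda> E"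
    and "bdry \<Lambda> \<inter> bdry E = bdry \<Lambda> \<inter> bdry D" "y \<in> BB s \<AA> p \<Lambda> D"
  shows "p E * y = y * p E"
proof -
  have abs: "p E * p D = p E" "p D * p E = p E"
    using net_of_projections_absorb[OF assms(1,2) _ assms(3)] assms(4) by (auto simp: surrounded_def)
  obtain z where z: "y = z * p D" "z * p E = p E * z"
    using assms(4-6) by (auto simp: BB_def)
  have "p E * y = z * (p E * p D)"
    using z by (metis mult.assoc)
  also have "\<dots> = y * p E"
    using z abs by (simp add: mult.assoc)
  finally show ?thesis .
qed

text \<open>Unique existence is part of the conclusion because \<open>EE\<close> is a definite
  description: it certifies that the common value is the intended operator.\<close>

theorem lemma2p29:
  fixes \<AA> :: "(int ^ 'n) set \<Rightarrow> 'a::unital_cstar_algebra set"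
    and p :: "(int ^ 'n) set \<Rightarrow> 'a"
    and \<alpha> :: "int ^ 'n \<Rightarrow> 'a \<Rightarrow> 'a"
    and r s :: nat
    and k :: 'n
    and H I \<Lambda> \<Delta> \<Delta>' :: "(int ^ 'n) set"
    and x :: 'a
  assumes "net_of_algebras \<AA>"
    and "net_of_projections \<AA> p"
    and "translation_invariant \<alpha> \<AA> p"
    and "r > 0" and "s > 0"
    and "LTO2 r s \<AA> p" and "LTO3 r s \<AA> p" and "LTO4 r s \<AA> p"
    and "half_space k H"
    and "rectangle \<Lambda>" and "sufficiently_large r \<Lambda>" and "\<Lambda> \<subseteq> H"
    and "I \<subseteq> coord_sublattice k"
    and "rectangle \<Delta>" and "\<Delta> \<subseteq> H" and "surrounded s \<Lambda> \<Delta>" and "bdry \<Lambda> \<inter> bdry \<Delta> = I"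
    and "rectangle \<Delta>'" and "\<Delta>' \<subseteq> H" and "surrounded s \<Lambda> \<Delta>'" and "bdry \<Lambda> \<inter> bdry \<Delta>' = I"
    and "x \<in> \<AA> \<Lambda>"
  shows "(\<exists>!y. y \<in> boundary_algebra r s \<AA> p k H I \<and> p \<Delta> * x * p \<Delta> = y * p \<Delta>) \<and>
         EE r s \<AA> p k H I \<Delta> x = EE r s \<AA> p k H I \<Delta>' x"
proof -
  note net = \<open>net_of_algebras \<AA>\<close> \<open>net_of_projections \<AA> p\<close>
  obtain \<sigma> :: int where \<sigma>: "\<sigma> = 1 \<or> \<sigma> = -1" and H: "H = {x. 0 \<le> \<sigma> * x $ k}"
    using half_space_sign[OF \<open>half_space k H\<close>] by blast
  have "codim1_rectangle I" "\<Lambda> \<subseteq> \<Delta>"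
    using \<open>surrounded s \<Lambda> \<Delta>\<close> \<open>bdry \<Lambda> \<inter> bdry \<Delta> = I\<close> by (auto simp: surrounded_def)
  then have "rectangle I" "I \<noteq> {}"
    by (auto simp: codim1_rectangle_def)
  then obtain a b where I: "I = slab \<sigma> k 0 a b" and ne: "slab \<sigma> k 0 a b \<noteq> {}"
    using rectangle_in_coord_sublattice_eq_slab[OF \<sigma> _ \<open>I \<subseteq> coord_sublattice k\<close>] by metis
  have sec: "\<Lambda> \<inter> coord_sublattice k = slab \<sigma> k 0 a b"
    using section_eq_common_bdry[OF \<sigma> \<open>\<Lambda> \<subseteq> \<Delta>\<close>] \<open>\<Delta> \<subseteq> H\<close> \<open>I \<subseteq> coord_sublattice k\<close> \<open>bdry \<Lambda> \<inter> bdry \<Delta> = I\<close>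
    unfolding H I by blast
  note large = sufficiently_large_section[OF \<sigma> \<open>rectangle \<Lambda>\<close> \<open>\<Lambda> \<subseteq> H\<close>[unfolded H] sec ne \<open>r > 0\<close>
      \<open>sufficiently_large r \<Lambda>\<close>]
  define L where "L = Lambda_of r k H I"
  define D where "D = Delta_of r s k H I"
  have L: "L = slab \<sigma> k (int r - 1) a b"
    unfolding L_def H I by (rule Lambda_of_eq_slab[OF \<sigma> \<open>r > 0\<close> large(1) ne])
  have D: "surrounded s L D" "bdry L \<inter> bdry D = I"
    and D_min: "\<And>E. surrounded s \<Lambda> E \<Longrightarrow> bdry \<Lambda> \<inter> bdry E = I \<Longrightarrow> D \<subseteq> E"
    using Delta_of_slab[OF \<sigma> \<open>r > 0\<close> \<open>s > 0\<close> large(1) ne] \<open>rectangle \<Lambda>\<close> \<open>\<Lambda> \<subseteq> H\<close>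
      \<open>sufficiently_large r \<Lambda>\<close> sec unfolding L D_def H I by blast+
  have BI: "boundary_algebra r s \<AA> p k H I = BB s \<AA> p L D"
    by (simp add: boundary_algebra_def L_def D_def)
  have rL: "rectangle L" and sL: "sufficiently_large r L" and rD: "rectangle D"
    using rectangle_slab[OF \<sigma>] sufficiently_large_slab[OF \<sigma> _ large(1)] D(1) by (auto simp: L surrounded_def)
  have L\<Lambda>: "L \<subseteq> \<Lambda>"
    using slab_subsetI[OF \<sigma> \<open>rectangle \<Lambda>\<close>] large(2) sec unfolding L by blast
  \<comment> \<open>A boundary site of \<open>E\<close> in \<open>L\<close> lies in
    \<open>\<Lambda>\<close>, hence on its boundary and so in \<open>I\<close>. This is what (LTO3)
    and (LTO4) ask of the pair \<open>L\<close>, \<open>E\<close>.\<close>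
  have LE: "bdry L \<inter> bdry E = I"
    if E: "E \<subseteq> H" "surrounded s \<Lambda> E" "bdry \<Lambda> \<inter> bdry E = I" for E
  proof -
    have "bdry L \<subseteq> \<Lambda>" "\<Lambda> \<subseteq> E"
      using L\<Lambda> E(2) by (auto simp: bdry_def surrounded_def)
    then have "bdry L \<inter> bdry E \<subseteq> I"
      unfolding E(3)[symmetric] using bdry_mono[of _ E \<Lambda>] by blast
    moreover have "I \<subseteq> bdry L"
      unfolding D(2)[symmetric] by (rule Int_lower1)
    moreover have "I \<subseteq> bdry E"
      unfolding E(3)[symmetric] by (rule Int_lower2)
    ultimately show ?thesis
      by blast
  qed
  have inj: "y = y'"
    if "y \<in> BB s \<AA> p L D" "y' \<in> BB s \<AA> p L D" "y * p E = y' * p E"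
      and "rectangle E" "D \<subseteq> E" "bdry L \<inter> bdry E = I" for y y' E
  proof -
    have "cstar_subalgebra (\<AA> L)"
      using net(1) rL by (simp add: net_of_algebras_def)
    then have "y - y' \<in> BB s \<AA> p L D"
      using BB_diff that(1,2) by blast
    moreover have "(y - y') * p E = 0"
      using that(3) by (simp add: left_diff_distrib)
    ultimately have "y - y' = 0"
      using \<open>LTO4 r s \<AA> p\<close>[unfolded LTO4_def, rule_format, of L D E "y - y'"] sL D that(4-6) by simp
    then show ?thesis
      by simp
  qed
  have ex: "\<exists>y \<in> BB s \<AA> p L D. p E * x * p E = y * p E"
    if E: "E \<subseteq> H" "surrounded s \<Lambda> E" "bdry \<Lambda> \<inter> bdry E = I" for E
  proof -
    have "p E * x * p E \<in> BB s \<AA> p \<Lambda> E"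
      using \<open>LTO2 r s \<AA> p\<close>[unfolded LTO2_def, rule_format, of \<Lambda> E] \<open>sufficiently_large r \<Lambda>\<close> \<open>x \<in> \<AA> \<Lambda>\<close> E(2)
      by (auto simp: corner_def)
    also have "BB s \<AA> p \<Lambda> E = BB s \<AA> p L E"
      using \<open>LTO3 r s \<AA> p\<close>[unfolded LTO3_def, rule_format, of L \<Lambda> E] rL sL \<open>sufficiently_large r \<Lambda>\<close>
        L\<Lambda> E LE[OF E] by simp
    finally obtain z where z: "p E * x * p E = z * p E" "z \<in> corner (p L) (\<AA> L)"
      "\<And>F. surrounded s L F \<Longrightarrow> bdry L \<inter> bdry F = I \<Longrightarrow> z * p F = p F * z"
      unfolding BB_def LE[OF E] by blast
    \<comment> \<open>The commutation condition on \<open>z\<close> depends on the outer rectangle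
      only through the common face, which is \<open>I\<close> for both \<open>E\<close> and
      \<open>D\<close>.\<close>
    have "z * p D \<in> BB s \<AA> p L D"
      unfolding BB_def D(2) using z(2,3) by blast
    moreover have "p D * p E = p E"
      using net_of_projections_absorb(2)[OF net(2) rD _ D_min] E by (auto simp: surrounded_def)
    ultimately show ?thesis
      using z(1) by (intro bexI[of _ "z * p D"]) (auto simp: mult.assoc)
  qed
  have ex1: "\<exists>!y. y \<in> BB s \<AA> p L D \<and> p E * x * p E = y * p E"
    if E: "E \<subseteq> H" "surrounded s \<Lambda> E" "bdry \<Lambda> \<inter> bdry E = I" for E
  proof -
    have "rectangle E"
      using E(2) by (simp add: surrounded_def)
    then show ?thesis
      using ex[OF E] inj[OF _ _ _ _ D_min[OF E(2,3)] LE[OF E]] by metis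
  qed
  \<comment> \<open>\<open>F\<close> is built around \<open>L\<close>, of height
    \<open>r - 1\<close>, rather than around \<open>\<Lambda>\<close>: both (LTO4) and the
    commutation property of B(I) refer to \<open>L\<close>.\<close>
  obtain F where F: "\<Delta> \<subseteq> F" "\<Delta>' \<subseteq> F" "surrounded s L F" "bdry L \<inter> bdry F = I"
    using large_surrounding_slab[OF \<sigma> \<open>s > 0\<close> _ ne \<open>rectangle \<Delta>\<close> \<open>rectangle \<Delta>'\<close> \<open>\<Delta> \<subseteq> H\<close>[unfolded H]
        \<open>\<Delta>' \<subseteq> H\<close>[unfolded H], of "int r - 1"] \<open>r > 0\<close> unfolding L I by auto
  have rF: "rectangle F"
    using F(3) by (simp add: surrounded_def)
  have DF: "D \<subseteq> F"
    using D_min \<open>surrounded s \<Lambda> \<Delta>\<close> \<open>bdry \<Lambda> \<inter> bdry \<Delta> = I\<close> F(1) by blast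
  have up: "p F * x * p F = y * p F"
    if "y \<in> BB s \<AA> p L D" "p E * x * p E = y * p E" "rectangle E" "E \<subseteq> F" for y E
  proof -
    note abs = net_of_projections_absorb[OF net(2) that(3) rF that(4)]
    have "p F * x * p F = p F * (p E * x * p E) * p F"
      using abs by (metis mult.assoc)
    also have "\<dots> = p F * y * p F"
      unfolding that(2) using abs by (simp add: mult.assoc)
    also have "\<dots> = y * (p F * p F)"
      using BB_commute[OF net(2) rD DF F(3) _ that(1)] F(4) D(2) by (simp add: mult.assoc)
    also have "p F * p F = p F"
      using net_of_projections_absorb(1)[OF net(2) rF rF] by simp
    finally show ?thesis .
  qed
  obtain y where y: "y \<in> BB s \<AA> p L D" "p \<Delta> * x * p \<Delta> = y * p \<Delta>"
    using ex[OF \<open>\<Delta> \<subseteq> H\<close> \<open>surrounded s \<Lambda> \<Delta>\<close> \<open>bdry \<Lambda> \<inter> bdry \<Delta> = I\<close>] by blast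
  obtain y' where y': "y' \<in> BB s \<AA> p L D" "p \<Delta>' * x * p \<Delta>' = y' * p \<Delta>'"
    using ex[OF \<open>\<Delta>' \<subseteq> H\<close> \<open>surrounded s \<Lambda> \<Delta>'\<close> \<open>bdry \<Lambda> \<inter> bdry \<Delta>' = I\<close>] by blast
  have "y = y'"
    using inj[OF y(1) y'(1) _ rF DF F(4)] up[OF y \<open>rectangle \<Delta>\<close> F(1)] up[OF y' \<open>rectangle \<Delta>'\<close> F(2)] by simp
  moreover have "EE r s \<AA> p k H I \<Delta> x = y"
    unfolding EE_def BI using y
    by (intro the1_equality ex1 conjI \<open>\<Delta> \<subseteq> H\<close> \<open>surrounded s \<Lambda> \<Delta>\<close> \<open>bdry \<Lambda> \<inter> bdry \<Delta> = I\<close>)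
  moreover have "EE r s \<AA> p k H I \<Delta>' x = y'"
    unfolding EE_def BI using y'
    by (intro the1_equality ex1 conjI \<open>\<Delta>' \<subseteq> H\<close> \<open>surrounded s \<Lambda> \<Delta>'\<close> \<open>bdry \<Lambda> \<inter> bdry \<Delta>' = I\<close>)
  ultimately show ?thesis
    unfolding BI using ex1[OF \<open>\<Delta> \<subseteq> H\<close> \<open>surrounded s \<Lambda> \<Delta>\<close> \<open>bdry \<Lambda> \<inter> bdry \<Delta> = I\<close>] by simp
qed

end
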